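(* Let $G$ be the path on vertices $1,\dots,n$, let $q=3$, and let $\Omega$ be the set of proper $3$-colorings of $G$. Let $\mathcal{M}_{\mathrm{Gl}}$ be the Glauber dynamics on $\Omega$. Then, as $n\to\infty$, $$\mathrm{Mix}\left(\mathcal{M}_{\mathrm{Gl}},\tfrac12\right)\ \ge\ \tfrac32\,\pi^{-2}\,n^3\ln n+O(n^3).$$
   Context: The $n$-vertex path has vertices $1,\dots,n$ and edges $\{i,i+1\}$. A $q$-coloring is a vector $\sigma=(\sigma_1,\dots,\sigma_n)\in\{0,\dots,q-1\}^n$; it is proper if adjacent vertices receive different colors. The procedure Metropolis($v$): choose a color $c\in\{0,\dots,q-1\}$ uniformly at random and propose recoloring $v$ with $c$; the proposal is accepted if and only if $c$ is not used at any neighbor of $v$ (otherwise the coloring is unchanged). One step of the Markov chain $\mathcal{M}_{\mathrm{Gl}}$ (Glauber dynamics): choose a vertex $v$ uniformly at random and do Metropolis($v$). Its stationary distribution is uniform on $\Omega$. For a Markov chain $\mathcal{M}$ with transition matrix $P$ and stationary distribution $\pi$, $\mathrm{Mix}_x(\mathcal{M},\varepsilon)=\min\{t>0:\mathrm{d_{TV}}(P^t(x,\cdot),\pi(\cdot))\le\varepsilon\}$ and $\mathrm{Mix}(\mathcal{M},\varepsilon)=\max_x\mathrm{Mix}_x(\mathcal{M},\varepsilon)$, where $\mathrm{d_{TV}}(\theta_1,\theta_2)=\frac12\sum_i|\theta_1(i)-\theta_2(i)|$. In the bound, $\pi$ is the numerical constant and the $O(n^3)$ term may have either sign. *)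

theory Defs
  imports "HOL-Probability.Probability" "HOL-Library.Landau_Symbols"
begin

section \<open>Mixing times of finite Markov chains\<close>

text \<open>
  A chain with transition matrix \<open>P\<close> is given by its kernel \<open>K\<close>, with \<open>P(x,y) = pmf (K x) y\<close>;
  \<open>step_distr K t x\<close> is the distribution \<open>P\<^sup>t(x,\<cdot>)\<close>.
\<close>

definition step_distr :: "('a \<Rightarrow> 'a pmf) \<Rightarrow> nat \<Rightarrow> 'a \<Rightarrow> 'a pmf" where
  "step_distr K t x = ((\<lambda>\<mu>. bind_pmf \<mu> K) ^^ t) (return_pmf x)"

definition stationary :: "('a \<Rightarrow> 'a pmf) \<Rightarrow> 'a pmf \<Rightarrow> bool" where
  "stationary K \<mu> \<longleftrightarrow> bind_pmf \<mu> K = \<mu>"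

definition tv_dist :: "'a set \<Rightarrow> 'a pmf \<Rightarrow> 'a pmf \<Rightarrow> real" where
  "tv_dist S \<mu> \<nu> = (1/2) * (\<Sum>i\<in>S. \<bar>pmf \<mu> i - pmf \<nu> i\<bar>)"

text \<open>
  The minimum is taken in \<^typ>\<open>enat\<close>, so that \<open>mix_from\<close> is \<open>\<infinity>\<close> if no such time exists. This
  does not happen for an irreducible aperiodic chain; a nonempty infimum is attained.
\<close>

definition mix_from :: "'a set \<Rightarrow> ('a \<Rightarrow> 'a pmf) \<Rightarrow> 'a pmf \<Rightarrow> real \<Rightarrow> 'a \<Rightarrow> enat" where
  "mix_from S K \<mu> \<epsilon> x = Inf (enat ` {t. t > 0 \<and> tv_dist S (step_distr K t x) \<mu> \<le> \<epsilon>})"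

definition mix :: "'a set \<Rightarrow> ('a \<Rightarrow> 'a pmf) \<Rightarrow> 'a pmf \<Rightarrow> real \<Rightarrow> enat" where
  "mix S K \<mu> \<epsilon> = Max (mix_from S K \<mu> \<epsilon> ` S)"


section \<open>Glauber dynamics for colorings of the path\<close>

definition path_edges :: "nat \<Rightarrow> nat set set" where
  "path_edges n = {{i, i + 1} |i. 1 \<le> i \<and> i < n}"

definition colorings :: "nat \<Rightarrow> nat \<Rightarrow> (nat \<Rightarrow> nat) set" where
  "colorings n q = {1..n} \<rightarrow>\<^sub>E {0..<q}"

definition proper_colorings :: "nat \<Rightarrow> nat \<Rightarrow> (nat \<Rightarrow> nat) set" where
  "proper_colorings n q =
     {\<sigma> \<in> colorings n q. \<forall>u v. {u, v} \<in> path_edges n \<longrightarrow> \<sigma> u \<noteq> \<sigma> v}"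

definition recolor :: "nat \<Rightarrow> nat \<Rightarrow> (nat \<Rightarrow> nat) \<Rightarrow> nat \<Rightarrow> nat \<Rightarrow> nat" where
  "recolor n v \<sigma> c = (if \<forall>u. {u, v} \<in> path_edges n \<longrightarrow> \<sigma> u \<noteq> c then \<sigma>(v := c) else \<sigma>)"

definition metropolis :: "nat \<Rightarrow> nat \<Rightarrow> nat \<Rightarrow> (nat \<Rightarrow> nat) \<Rightarrow> (nat \<Rightarrow> nat) pmf" where
  "metropolis n q v \<sigma> = map_pmf (recolor n v \<sigma>) (pmf_of_set {0..<q})"

definition glauber :: "nat \<Rightarrow> nat \<Rightarrow> (nat \<Rightarrow> nat) \<Rightarrow> (nat \<Rightarrow> nat) pmf" where
  "glauber n q \<sigma> = bind_pmf (pmf_of_set {1..n}) (\<lambda>v. metropolis n q v \<sigma>)"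


subsection \<open>The uniform distribution on proper colorings is stationary\<close>

lemma finite_proper_colorings: "finite (proper_colorings n q)"
  by (rule finite_subset[of _ "{1..n} \<rightarrow>\<^sub>E {0..<q}"])
    (auto simp: proper_colorings_def colorings_def intro!: finite_PiE)

lemma proper_colorings_nonempty:
  assumes "q \<ge> 2"
  shows "proper_colorings n q \<noteq> {}"
proof -
  have "(\<lambda>i\<in>{1..n}. i mod 2) \<in> proper_colorings n q"
  proof -
    let ?\<sigma> = "\<lambda>i\<in>{1..n}. i mod 2"
    have "i mod 2 < q" for i :: nat
      using assms by (intro less_le_trans[of _ 2 q]) simp_all
    then have "?\<sigma> \<in> colorings n q"
      by (simp add: colorings_def)
    moreover have "?\<sigma> u \<noteq> ?\<sigma> v" if edge: "{u, v} \<in> path_edges n" for u v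
    proof -
      have "u \<in> {1..n}" "v \<in> {1..n}" "v = Suc u \<or> u = Suc v"
        using edge by (auto simp: path_edges_def doubleton_eq_iff)
      then show ?thesis by (auto simp: mod_Suc split: if_splits)
    qed
    ultimately show ?thesis by (simp add: proper_colorings_def)
  qed
  then show ?thesis by blast
qed

lemma singleton_notin_path_edges: "{v} \<notin> path_edges n"
  by (auto simp: path_edges_def)

lemma recolor_proper:
  assumes "\<sigma> \<in> proper_colorings n q" "v \<in> {1..n}" "c \<in> {0..<q}"
  shows "recolor n v \<sigma> c \<in> proper_colorings n q"
proof -
  have "\<sigma>(v := c) \<in> proper_colorings n q" if free: "\<forall>u. {u, v} \<in> path_edges n \<longrightarrow> \<sigma> u \<noteq> c"
  proof -
    have "\<sigma>(v := c) \<in> colorings n q"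
      using assms by (auto simp: proper_colorings_def colorings_def PiE_iff extensional_def)
    moreover have "(\<sigma>(v := c)) a \<noteq> (\<sigma>(v := c)) b" if ab: "{a, b} \<in> path_edges n" for a b
    proof -
      have "a \<noteq> b" using ab singleton_notin_path_edges by auto
      moreover have "{b, a} \<in> path_edges n" using ab by (simp add: insert_commute)
      moreover have "\<sigma> a \<noteq> \<sigma> b" using assms(1) ab by (simp add: proper_colorings_def)
      ultimately show ?thesis using free ab by auto
    qed
    ultimately show ?thesis by (simp add: proper_colorings_def)
  qed
  then show ?thesis using assms(1) by (simp add: recolor_def)
qed

lemma metropolis_stationary:
  assumes "q \<ge> 2" "v \<in> {1..n}"
  shows "stationary (metropolis n q v) (pmf_of_set (proper_colorings n q))"
proof -
  define S where "S = proper_colorings n q"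
  define C where "C = {0..<q}"
  define f where "f = (\<lambda>(\<sigma>, c). (recolor n v \<sigma> c,
    if \<forall>u. {u, v} \<in> path_edges n \<longrightarrow> \<sigma> u \<noteq> c then \<sigma> v else c))"
  have fin: "finite S" "S \<noteq> {}" "finite C" "C \<noteq> {}"
    using finite_proper_colorings proper_colorings_nonempty assms by (auto simp: S_def C_def)
  have proper: "\<sigma> u \<noteq> \<sigma> v" if "\<sigma> \<in> S" "{u, v} \<in> path_edges n" for \<sigma> u
    using that by (auto simp: S_def proper_colorings_def)
  have nv: "u \<noteq> v" if "{u, v} \<in> path_edges n" for u
    using that singleton_notin_path_edges by auto
  have f_in: "f x \<in> S \<times> C" if xin: "x \<in> S \<times> C" for x
  proof -
    obtain \<sigma> c where x: "x = (\<sigma>, c)" and mem: "\<sigma> \<in> S" "c \<in> C"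
      using xin by blast
    have "recolor n v \<sigma> c \<in> S"
      using mem assms(2) recolor_proper unfolding S_def C_def by blast
    moreover have "\<sigma> v \<in> C"
      using mem(1) assms(2) by (auto simp: S_def C_def proper_colorings_def colorings_def)
    ultimately show ?thesis using mem(2) by (simp add: x f_def)
  qed
  have f_f: "f (f x) = x" if xin: "x \<in> S \<times> C" for x
  proof -
    obtain \<sigma> c where x: "x = (\<sigma>, c)" and \<sigma>: "\<sigma> \<in> S"
      using xin by blast
    show ?thesis
    proof (cases "\<forall>u. {u, v} \<in> path_edges n \<longrightarrow> \<sigma> u \<noteq> c")
      case True
      have "\<forall>u. {u, v} \<in> path_edges n \<longrightarrow> (\<sigma>(v := c)) u \<noteq> \<sigma> v"
        using proper[OF \<sigma>] nv by simp
      with True show ?thesis by (simp add: x f_def recolor_def)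
    next
      case False
      then have "f x = x" unfolding x f_def recolor_def by (simp only: if_False case_prod_conv)
      then show ?thesis by simp
    qed
  qed
  have bij: "bij_betw f (S \<times> C) (S \<times> C)"
    by (rule bij_betw_byWitness[where f' = f]) (use f_in f_f in blast)+
  have pair: "pair_pmf (pmf_of_set S) (pmf_of_set C) = pmf_of_set (S \<times> C)"
  proof (rule pmf_eqI)
    fix x :: "(nat \<Rightarrow> nat) \<times> nat"
    have "S \<times> C \<noteq> {}" "finite (S \<times> C)" using fin by auto
    then show "pmf (pair_pmf (pmf_of_set S) (pmf_of_set C)) x = pmf (pmf_of_set (S \<times> C)) x"
      by (cases x) (simp add: pmf_pair pmf_of_set[OF fin(2,1)] pmf_of_set[OF fin(4,3)] pmf_of_set
          card_cartesian_product indicator_times)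
  qed
  have "bind_pmf (pmf_of_set S) (\<lambda>\<sigma>. metropolis n q v \<sigma>)
      = map_pmf fst (map_pmf f (pair_pmf (pmf_of_set S) (pmf_of_set C)))"
    by (simp add: metropolis_def[abs_def] C_def f_def pair_pmf_def map_pmf_def bind_assoc_pmf
        bind_return_pmf)
  also have "\<dots> = map_pmf fst (pair_pmf (pmf_of_set S) (pmf_of_set C))"
    unfolding pair by (subst map_pmf_of_set_bij_betw[OF bij]) (use fin in auto)
  finally show ?thesis
    by (simp add: stationary_def S_def map_fst_pair_pmf)
qed

lemma glauber_stationary:
  assumes "n \<ge> 1" "q \<ge> 2"
  shows "stationary (glauber n q) (pmf_of_set (proper_colorings n q))"
proof -
  have "bind_pmf (pmf_of_set (proper_colorings n q)) (glauber n q) = bind_pmf (pmf_of_set {1..n})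
      (\<lambda>v. bind_pmf (pmf_of_set (proper_colorings n q)) (metropolis n q v))"
    unfolding glauber_def by (rule bind_commute_pmf)
  also have "\<dots> = bind_pmf (pmf_of_set {1..n}) (\<lambda>v. pmf_of_set (proper_colorings n q))"
    by (rule bind_pmf_cong[OF refl])
      (use assms metropolis_stationary in \<open>auto simp: stationary_def\<close>)
  finally show ?thesis by (simp add: stationary_def)
qed

end

theory Submission
  imports Defs "HOL-Real_Asymp.Real_Asymp"
begin

text \<open>
  Reading a proper 3-coloring from left to right, each edge carries a spin \<open>+1\<close> or \<open>-1\<close>, according
  to whether the color increases or decreases by one modulo 3. Recoloring an interior vertex is
  possible only if its two edges have opposite spins, and then exchanges them; recoloring an end
  vertex flips the spin of the end edge. So the spins perform a symmetric exclusion process on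
  \<open>n - 1\<close> sites with reservoirs at both ends, and their expectations follow a discrete heat equation
  whose slowest mode is \<open>sin (\<pi> (i - 1/2) / (n - 1))\<close>. The corresponding linear statistic \<open>mode\<close> is
  therefore an eigenfunction of the Glauber dynamics (\<open>mode_drift\<close>), with eigenvalue \<open>1 - \<gamma>\<close> where
  \<open>\<gamma> = mode_gap n\<close> is about \<open>\<pi>\<^sup>2 / (3 n\<^sup>3)\<close>.

  Wilson's method turns this into a lower bound on the mixing time. From the coloring with all spins
  \<open>+1\<close> the statistic starts at order \<open>n\<close> (\<open>mode_staircase\<close>), and its mean after \<open>t\<close> steps is
  \<open>(1 - \<gamma>)\<^sup>t\<close> times that, whereas its stationary mean is 0. One step changes it by \<open>O(1/n)\<close>
  (\<open>mode_increment\<close>), because a spin exchange only sees the difference of neighbouring weights.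
  Hence its variance stays \<open>O(n)\<close> at all times, and in equilibrium. As long as the mean is a
  large multiple of \<open>\<surd>n\<close>, the two distributions are far apart
  (\<open>tv_dist_stationary\<close>). The mean drops from order \<open>n\<close> to order \<open>\<surd>n\<close> only at time
  \<open>(ln n) / (2 \<gamma>) \<approx> (3/2) \<pi>\<^sup>-\<^sup>2 n\<^sup>3 ln n\<close>; a constant factor in the comparison shifts this time by
  \<open>O(1/\<gamma>) = O(n\<^sup>3)\<close>.
\<close>

section \<open>Wilson's method\<close>

lemma expectation_finite_support:
  fixes f :: "'a \<Rightarrow> real"
  assumes "finite S" "set_pmf p \<subseteq> S"
  shows "measure_pmf.expectation p f = (\<Sum>a\<in>S. pmf p a * f a)"
  using integral_measure_pmf_real[of S p f] assms by (auto simp: mult.commute)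

lemma expectation_bind_finite_support:
  fixes f :: "'a \<Rightarrow> real"
  assumes "finite S" "set_pmf p \<subseteq> S" "\<And>x. x \<in> S \<Longrightarrow> set_pmf (K x) \<subseteq> S"
  shows "measure_pmf.expectation (bind_pmf p K) f
    = (\<Sum>a\<in>S. pmf p a * measure_pmf.expectation (K a) f)"
  using pmf_expectation_bind[of S K p f] assms by (auto intro: finite_subset)

text \<open>
  A test function with different means and small second moments separates two distributions. This is
  Cauchy--Schwarz for the sum of \<open>(p - q) g\<close> with weight \<open>\<bar>p - q\<bar> \<le> p + q\<close>; the total mass of the
  weight is twice the distance.
\<close>

lemma tv_dist_second_moment:
  fixes g :: "'a \<Rightarrow> real"
  assumes S: "finite S" "set_pmf p \<subseteq> S" "set_pmf q \<subseteq> S"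
  shows "(measure_pmf.expectation p g - measure_pmf.expectation q g)\<^sup>2 \<le> 2 * tv_dist S p q *
    (measure_pmf.expectation p (\<lambda>x. (g x)\<^sup>2) + measure_pmf.expectation q (\<lambda>x. (g x)\<^sup>2))"
proof -
  define D where "D = (\<lambda>x. \<bar>pmf p x - pmf q x\<bar>)"
  have D: "D x \<ge> 0" "D x \<le> pmf p x + pmf q x" for x
    using pmf_nonneg[of p x] pmf_nonneg[of q x] by (auto simp: D_def abs_real_def)
  have "\<bar>measure_pmf.expectation p g - measure_pmf.expectation q g\<bar>
      = \<bar>\<Sum>x\<in>S. (pmf p x - pmf q x) * g x\<bar>"
    by (simp add: expectation_finite_support[OF S(1,2)] expectation_finite_support[OF S(1,3)]
        sum_subtractf left_diff_distrib)
  also have "\<dots> \<le> (\<Sum>x\<in>S. sqrt (D x) * (sqrt (D x) * \<bar>g x\<bar>))"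
    using D by (intro order.trans[OF sum_abs] sum_mono)
      (simp add: abs_mult mult.assoc[symmetric] D_def)
  finally have "(measure_pmf.expectation p g - measure_pmf.expectation q g)\<^sup>2
      \<le> (\<Sum>x\<in>S. sqrt (D x) * (sqrt (D x) * \<bar>g x\<bar>))\<^sup>2"
    by (metis abs_ge_zero power2_abs power_mono)
  also have "\<dots> \<le> (\<Sum>x\<in>S. (sqrt (D x))\<^sup>2) * (\<Sum>x\<in>S. (sqrt (D x) * \<bar>g x\<bar>)\<^sup>2)"
    by (rule Cauchy_Schwarz_ineq_sum)
  also have "\<dots> = (\<Sum>x\<in>S. D x) * (\<Sum>x\<in>S. D x * (g x)\<^sup>2)"
    using D by (simp add: power_mult_distrib)
  also have "\<dots> \<le> (\<Sum>x\<in>S. D x) * (\<Sum>x\<in>S. (pmf p x + pmf q x) * (g x)\<^sup>2)"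
    using D by (intro mult_left_mono sum_mono mult_right_mono sum_nonneg) auto
  finally show ?thesis
    by (simp add: expectation_finite_support[OF S(1,2)] expectation_finite_support[OF S(1,3)]
        sum.distrib distrib_right tv_dist_def D_def)
qed

lemma step_distr_Suc: "step_distr K (Suc t) x = bind_pmf (step_distr K t x) K"
  by (simp add: step_distr_def)

lemma step_distr_support:
  assumes "\<And>y. y \<in> S \<Longrightarrow> set_pmf (K y) \<subseteq> S" "x \<in> S"
  shows "set_pmf (step_distr K t x) \<subseteq> S"
proof (induction t)
  case 0
  then show ?case using assms by (simp add: step_distr_def)
next
  case (Suc t)
  then show ?case using assms by (auto simp: step_distr_Suc)
qed

text \<open>
  Only the mean square \<open>R\<close> of one increment enters: an eigenfunction contracts towards 0 at rate
  \<open>\<gamma>\<close>, and the noise added in one step balances the contraction of the second moment at the level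
  \<open>R / (2 \<gamma>)\<close>. The bound \<open>\<gamma> \<le> 1/2\<close> keeps the factor \<open>1 - 2 \<gamma>\<close> of the second moment nonnegative.
\<close>

locale eigenfunction_bounded_increments =
  fixes S :: "'a set" and K :: "'a \<Rightarrow> 'a pmf" and f :: "'a \<Rightarrow> real" and \<gamma> R :: real
  assumes finite_S: "finite S"
    and K_support: "\<And>x. x \<in> S \<Longrightarrow> set_pmf (K x) \<subseteq> S"
    and drift: "\<And>x. x \<in> S \<Longrightarrow> measure_pmf.expectation (K x) f = (1 - \<gamma>) * f x"
    and increment: "\<And>x. x \<in> S \<Longrightarrow> measure_pmf.expectation (K x) (\<lambda>y. (f y - f x)\<^sup>2) \<le> R"
    and gap: "0 < \<gamma>" "\<gamma> \<le> 1/2"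
begin

lemma mean_step:
  assumes "set_pmf p \<subseteq> S"
  shows "measure_pmf.expectation (bind_pmf p K) f = (1 - \<gamma>) * measure_pmf.expectation p f"
proof -
  have "measure_pmf.expectation (bind_pmf p K) f = (\<Sum>a\<in>S. pmf p a * ((1 - \<gamma>) * f a))"
    using expectation_bind_finite_support[OF finite_S assms K_support] by (simp add: drift)
  then show ?thesis
    by (simp add: expectation_finite_support[OF finite_S assms] sum_distrib_left mult.left_commute)
qed

text \<open>
  Expanding \<open>(f y)\<^sup>2\<close> around \<open>f x\<close>, the cross term is \<open>2 f x\<close> times the drift \<open>- \<gamma> f x\<close>, so the
  square contracts by \<open>1 - 2 \<gamma>\<close>.
\<close>

lemma second_moment_local:
  assumes x: "x \<in> S"
  shows "measure_pmf.expectation (K x) (\<lambda>y. (f y)\<^sup>2) \<le> (1 - 2 * \<gamma>) * (f x)\<^sup>2 + R"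
proof -
  have int: "integrable (measure_pmf (K x)) g" for g :: "'a \<Rightarrow> real"
    using x K_support finite_S by (meson finite_subset integrable_measure_pmf_finite)
  have "measure_pmf.expectation (K x) (\<lambda>y. (f y)\<^sup>2)
      = measure_pmf.expectation (K x) (\<lambda>y. (f y - f x)\<^sup>2 + (2 * f x * f y - (f x)\<^sup>2))"
    by (rule Bochner_Integration.integral_cong) (simp_all add: power2_eq_square algebra_simps)
  also have "\<dots> = measure_pmf.expectation (K x) (\<lambda>y. (f y - f x)\<^sup>2)
      + (2 * f x * measure_pmf.expectation (K x) f - (f x)\<^sup>2)"
    using int by simp
  also have "\<dots> \<le> R + (2 * f x * ((1 - \<gamma>) * f x) - (f x)\<^sup>2)"
    using increment[OF x] drift[OF x] by simp
  finally show ?thesis by (simp add: power2_eq_square algebra_simps)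
qed

lemma second_moment_step:
  assumes p: "set_pmf p \<subseteq> S"
  shows "measure_pmf.expectation (bind_pmf p K) (\<lambda>y. (f y)\<^sup>2)
    \<le> (1 - 2 * \<gamma>) * measure_pmf.expectation p (\<lambda>y. (f y)\<^sup>2) + R"
proof -
  have "measure_pmf.expectation (bind_pmf p K) (\<lambda>y. (f y)\<^sup>2)
      = (\<Sum>a\<in>S. pmf p a * measure_pmf.expectation (K a) (\<lambda>y. (f y)\<^sup>2))"
    using p finite_S K_support by (intro expectation_bind_finite_support)
  also have "\<dots> \<le> (\<Sum>a\<in>S. pmf p a * ((1 - 2 * \<gamma>) * (f a)\<^sup>2 + R))"
    by (intro sum_mono mult_left_mono second_moment_local) auto
  also have "\<dots> = (1 - 2 * \<gamma>) * (\<Sum>a\<in>S. pmf p a * (f a)\<^sup>2) + (\<Sum>a\<in>S. pmf p a) * R"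
    by (simp add: distrib_left sum.distrib sum_distrib_left sum_distrib_right mult.left_commute)
  also have "(\<Sum>a\<in>S. pmf p a) = 1"
    using p finite_S by (rule sum_pmf_eq_1[rotated])
  finally show ?thesis
    using p finite_S by (simp add: expectation_finite_support[of S])
qed

lemma mean_after:
  assumes "x \<in> S"
  shows "measure_pmf.expectation (step_distr K t x) f = (1 - \<gamma>) ^ t * f x"
proof (induction t)
  case 0
  then show ?case by (simp add: step_distr_def)
next
  case (Suc t)
  then show ?case
    using mean_step[OF step_distr_support[of S K, OF K_support assms]]
    by (simp add: step_distr_Suc)
qed

text \<open>
  This bounds the variance by \<open>R / (2 \<gamma>)\<close> uniformly in time. The value \<open>R / (2 \<gamma>)\<close> is the fixed point of
  the recursion for second moments, and \<open>1 - 2 \<gamma> \<le> (1 - \<gamma>)\<^sup>2\<close> compares the contraction of the second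
  moment with that of the squared mean.
\<close>

lemma second_moment_after:
  assumes x: "x \<in> S"
  shows "measure_pmf.expectation (step_distr K t x) (\<lambda>y. (f y)\<^sup>2)
    \<le> ((1 - \<gamma>) ^ t * f x)\<^sup>2 + R / (2 * \<gamma>)"
proof -
  have R: "R \<ge> 0"
    using increment[OF x] by (rule order.trans[rotated]) simp
  have "measure_pmf.expectation (step_distr K t x) (\<lambda>y. (f y)\<^sup>2)
      \<le> (1 - 2 * \<gamma>) ^ t * (f x)\<^sup>2 + R / (2 * \<gamma>)"
  proof (induction t)
    case 0
    then show ?case using R gap by (simp add: step_distr_def)
  next
    case (Suc t)
    have "measure_pmf.expectation (step_distr K (Suc t) x) (\<lambda>y. (f y)\<^sup>2)
        \<le> (1 - 2 * \<gamma>) * measure_pmf.expectation (step_distr K t x) (\<lambda>y. (f y)\<^sup>2) + R"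
      unfolding step_distr_Suc
      by (rule second_moment_step[OF step_distr_support[of S K, OF K_support x]])
    also have "\<dots> \<le> (1 - 2 * \<gamma>) * ((1 - 2 * \<gamma>) ^ t * (f x)\<^sup>2 + R / (2 * \<gamma>)) + R"
      using gap Suc by (intro add_right_mono mult_left_mono) auto
    also have "\<dots> = (1 - 2 * \<gamma>) ^ Suc t * (f x)\<^sup>2 + R / (2 * \<gamma>)"
      using gap by (simp add: field_simps)
    finally show ?case .
  qed
  moreover have "(1 - 2 * \<gamma>) ^ t \<le> ((1 - \<gamma>)\<^sup>2) ^ t"
    using gap by (intro power_mono) (auto simp: power2_eq_square algebra_simps)
  then have "(1 - 2 * \<gamma>) ^ t * (f x)\<^sup>2 \<le> ((1 - \<gamma>)\<^sup>2) ^ t * (f x)\<^sup>2"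
    by (intro mult_right_mono) auto
  ultimately show ?thesis
    by (simp add: power_mult_distrib power_mult[symmetric] mult.commute)
qed

text \<open>
  The second moment inequality is applied to \<open>f - m / 2\<close>, where \<open>m\<close> is the mean at time \<open>t\<close>: the two
  means become \<open>m / 2\<close> and \<open>- m / 2\<close>, which minimizes the sum of the second moments. With both
  variances at most \<open>V = R / (2 \<gamma>)\<close> the distance is at least \<open>m\<^sup>2 / (m\<^sup>2 + 4 V)\<close>, which exceeds
  \<open>1/2\<close> once \<open>m\<^sup>2 > 4 V\<close>.
\<close>

lemma tv_dist_stationary:
  assumes x: "x \<in> S" and \<mu>: "set_pmf \<mu> \<subseteq> S" "stationary K \<mu>"
    and large: "((1 - \<gamma>) ^ t * f x)\<^sup>2 > 2 * R / \<gamma>"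
  shows "tv_dist S (step_distr K t x) \<mu> > 1/2"
proof (rule ccontr)
  assume small: "\<not> tv_dist S (step_distr K t x) \<mu> > 1/2"
  define p where "p = step_distr K t x"
  define m where "m = (1 - \<gamma>) ^ t * f x"
  define g where "g = (\<lambda>y. f y - m / 2)"
  have p: "set_pmf p \<subseteq> S"
    unfolding p_def by (rule step_distr_support[of S K, OF K_support x])
  have int: "integrable (measure_pmf r) h"
    if "set_pmf r \<subseteq> S" for r and h :: "'a \<Rightarrow> real"
    using that finite_S by (meson finite_subset integrable_measure_pmf_finite)
  have shift: "measure_pmf.expectation r (\<lambda>y. (g y)\<^sup>2) = measure_pmf.expectation r (\<lambda>y. (f y)\<^sup>2)
      - m * measure_pmf.expectation r f + m\<^sup>2 / 4" if r: "set_pmf r \<subseteq> S" for r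
  proof -
    have "measure_pmf.expectation r (\<lambda>y. (g y)\<^sup>2)
        = measure_pmf.expectation r (\<lambda>y. (f y)\<^sup>2 - m * f y + m\<^sup>2 / 4)"
      by (rule Bochner_Integration.integral_cong)
        (simp_all add: g_def power2_eq_square algebra_simps)
    then show ?thesis using int[OF r] by simp
  qed
  have mean_p: "measure_pmf.expectation p f = m"
    unfolding p_def m_def using x by (rule mean_after)
  have sq_p: "measure_pmf.expectation p (\<lambda>y. (f y)\<^sup>2) \<le> m\<^sup>2 + R / (2 * \<gamma>)"
    unfolding p_def m_def using x by (rule second_moment_after)
  have "measure_pmf.expectation \<mu> f = (1 - \<gamma>) * measure_pmf.expectation \<mu> f"
    using mean_step[OF \<mu>(1)] \<mu>(2) by (simp add: stationary_def)
  then have mean_\<mu>: "measure_pmf.expectation \<mu> f = 0"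
    using gap by (simp add: algebra_simps)
  have "measure_pmf.expectation \<mu> (\<lambda>y. (f y)\<^sup>2)
      \<le> (1 - 2 * \<gamma>) * measure_pmf.expectation \<mu> (\<lambda>y. (f y)\<^sup>2) + R"
    using second_moment_step[OF \<mu>(1)] \<mu>(2) by (simp add: stationary_def)
  then have sq_\<mu>: "measure_pmf.expectation \<mu> (\<lambda>y. (f y)\<^sup>2) \<le> R / (2 * \<gamma>)"
    using gap by (simp add: field_simps)
  have diff: "measure_pmf.expectation p g - measure_pmf.expectation \<mu> g = m"
    using int[OF p] int[OF \<mu>(1)] mean_p mean_\<mu> by (simp add: g_def)
  let ?Q = "measure_pmf.expectation p (\<lambda>y. (g y)\<^sup>2) + measure_pmf.expectation \<mu> (\<lambda>y. (g y)\<^sup>2)"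
  have "m\<^sup>2 \<le> 2 * tv_dist S p \<mu> * ?Q"
    using tv_dist_second_moment[OF finite_S p \<mu>(1), of g] unfolding diff .
  also have "\<dots> \<le> 1 * ?Q"
    using small by (intro mult_right_mono add_nonneg_nonneg) (auto simp: p_def)
  also have "\<dots> \<le> m\<^sup>2 / 2 + R / \<gamma>"
  proof -
    have "?Q = measure_pmf.expectation p (\<lambda>y. (f y)\<^sup>2) + measure_pmf.expectation \<mu> (\<lambda>y. (f y)\<^sup>2)
        - m\<^sup>2 / 2"
      unfolding shift[OF p] shift[OF \<mu>(1)] mean_p mean_\<mu> by (simp add: power2_eq_square)
    moreover have "R / (2 * \<gamma>) + R / (2 * \<gamma>) = R / \<gamma>" using gap by (simp add: field_simps)
    ultimately show ?thesis using sq_p sq_\<mu> unfolding mult_1 by linarith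
  qed
  finally show False using large by (simp add: m_def)
qed

end

lemma mix_lower_bound:
  assumes "finite S" "x \<in> S"
    and "\<And>t. real t \<le> T \<Longrightarrow> tv_dist S (step_distr K t x) \<mu> > \<epsilon>"
  shows "ereal T \<le> ereal_of_enat (mix S K \<mu> \<epsilon>)"
proof -
  let ?A = "{t. t > 0 \<and> tv_dist S (step_distr K t x) \<mu> \<le> \<epsilon>}"
  have "ereal T \<le> ereal_of_enat (mix_from S K \<mu> \<epsilon> x)"
  proof (cases "?A = {}")
    case True
    then show ?thesis by (simp add: mix_from_def Inf_enat_def)
  next
    case False
    then have "enat ` ?A \<noteq> {}" by blast
    then have "Inf (enat ` ?A) \<in> enat ` ?A"
      unfolding Inf_enat_def by (auto simp only: if_False intro: LeastI)
    then obtain t where t: "t \<in> ?A" "mix_from S K \<mu> \<epsilon> x = enat t"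
      unfolding mix_from_def by blast
    with assms(3)[of t] show ?thesis by force
  qed
  also have "\<dots> \<le> ereal_of_enat (mix S K \<mu> \<epsilon>)"
    unfolding mix_def using assms by simp
  finally show ?thesis .
qed

section \<open>The slowest mode of the Glauber dynamics\<close>

definition orient :: "nat \<Rightarrow> nat \<Rightarrow> real" where
  "orient a b = (if (a + 1) mod 3 = b then 1 else -1)"

text \<open>
  The value 0 at the sites \<open>0\<close> and \<open>n\<close> represents the reservoirs. Together with the antisymmetric
  continuation of the weights beyond the ends it gives end vertices the same drift formula as
  interior ones.
\<close>

definition spin :: "nat \<Rightarrow> (nat \<Rightarrow> nat) \<Rightarrow> nat \<Rightarrow> real" where
  "spin n \<sigma> i = (if 1 \<le> i \<and> i < n then orient (\<sigma> i) (\<sigma> (i + 1)) else 0)"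

definition weight :: "nat \<Rightarrow> nat \<Rightarrow> real" where
  "weight n i = sin (pi / (real n - 1) * (real i - 1/2))"

definition mode :: "nat \<Rightarrow> (nat \<Rightarrow> nat) \<Rightarrow> real" where
  "mode n \<sigma> = (\<Sum>i\<le>n. weight n i * spin n \<sigma> i)"

text \<open>
  The factor \<open>1 / (3 n)\<close> is the probability of proposing a given vertex and a given color; the rest is
  the lowest eigenvalue of the discrete Laplacian on the weights.
\<close>

definition mode_gap :: "nat \<Rightarrow> real" where
  "mode_gap n = 2 / (3 * real n) * (1 - cos (pi / (real n - 1)))"

text \<open>
  The half-integer shift makes the weights odd about the midpoints of \<open>{0, 1}\<close> and \<open>{n - 1, n}\<close>.
  Flipping the first spin \<open>x\<close> changes the mode by \<open>- 2 x\<close> times \<open>weight n 1\<close>. By oddness this is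
  \<open>(weight n 1 - weight n 0) (0 - x)\<close>, the mean effect of an exchange of \<open>x\<close> with a reservoir of
  mean spin 0.
\<close>

lemma weight_left: "weight n 0 = - weight n 1"
  by (simp add: weight_def flip: sin_minus)

lemma weight_right:
  assumes "n \<ge> 2"
  shows "weight n n = - weight n (n - 1)"
proof -
  define N where "N = real n - 1"
  have N: "N > 0" using assms by (simp add: N_def)
  have "pi / N * (real n - 1/2) = pi + pi / (2 * N)"
    using N by (simp add: N_def field_simps)
  moreover have "pi / N * (real (n - 1) - 1/2) = pi - pi / (2 * N)"
    using N assms by (simp add: N_def field_simps of_nat_diff)
  ultimately show ?thesis
    by (simp add: weight_def N_def)
qed

lemma weight_laplacian:
  assumes "i \<ge> 1"
  shows "weight n (i + 1) - 2 * weight n i + weight n (i - 1)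
    = - 2 * (1 - cos (pi / (real n - 1))) * weight n i"
proof -
  define h where "h = pi / (real n - 1)"
  define y where "y = h * (real i - 1/2)"
  have "h * (real (i + 1) - 1/2) = y + h" "h * (real (i - 1) - 1/2) = y - h"
    using assms by (simp_all add: y_def of_nat_diff algebra_simps)
  then have "weight n (i + 1) = sin (y + h)" "weight n (i - 1) = sin (y - h)" "weight n i = sin y"
    unfolding weight_def h_def[symmetric] y_def by (simp_all only:)
  then show ?thesis
    by (simp add: h_def[symmetric] sin_add sin_diff algebra_simps)
qed

lemma weight_lipschitz:
  assumes "n \<ge> 2" "v \<ge> 1"
  shows "\<bar>weight n v - weight n (v - 1)\<bar> \<le> pi / (real n - 1)"
proof -
  have "\<bar>sin x - sin y\<bar> \<le> \<bar>x - y\<bar>" for x y :: real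
  proof -
    have "\<bar>sin x - sin y\<bar> = 2 * \<bar>sin ((x - y) / 2)\<bar> * \<bar>cos ((x + y) / 2)\<bar>"
      by (simp add: sin_diff_sin abs_mult)
    also have "\<dots> \<le> 2 * \<bar>(x - y) / 2\<bar> * 1"
      by (intro mult_mono abs_sin_x_le_abs_x) auto
    finally show ?thesis by simp
  qed
  then have "\<bar>weight n v - weight n (v - 1)\<bar>
      \<le> \<bar>pi / (real n - 1) * (real v - 1/2) - pi / (real n - 1) * (real (v - 1) - 1/2)\<bar>"
    unfolding weight_def .
  also have "pi / (real n - 1) * (real v - 1/2) - pi / (real n - 1) * (real (v - 1) - 1/2)
      = pi / (real n - 1)"
    unfolding right_diff_distrib[symmetric] using assms by (simp add: of_nat_diff)
  finally show ?thesis using assms by simp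
qed

lemma color_less_3:
  assumes "\<sigma> \<in> proper_colorings n 3" "i \<in> {1..n}"
  shows "\<sigma> i \<in> {0, 1, 2}"
proof -
  have "\<sigma> i \<in> {0..<3}"
    using assms by (auto simp: proper_colorings_def colorings_def PiE_iff)
  then show ?thesis by auto
qed

lemma adjacent_colors:
  assumes "\<sigma> \<in> proper_colorings n 3" "1 \<le> i" "i < n"
  shows "\<sigma> i \<noteq> \<sigma> (Suc i)"
proof -
  have "{i, Suc i} \<in> path_edges n" using assms by (auto simp: path_edges_def)
  with assms(1) show ?thesis by (auto simp: proper_colorings_def)
qed

lemma neighbour_iff:
  assumes "v \<in> {1..n}"
  shows "{u, v} \<in> path_edges n \<longleftrightarrow> (1 \<le> u \<and> u + 1 = v) \<or> (u = v + 1 \<and> v < n)"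
  using assms by (auto simp: path_edges_def doubleton_eq_iff)

lemma mode_recolor_diff:
  assumes "v \<in> {1..n}"
  shows "mode n (recolor n v \<sigma> c) - mode n \<sigma>
    = weight n (v - 1) * (spin n (recolor n v \<sigma> c) (v - 1) - spin n \<sigma> (v - 1))
      + weight n v * (spin n (recolor n v \<sigma> c) v - spin n \<sigma> v)"
proof -
  let ?\<sigma>' = "recolor n v \<sigma> c"
  let ?d = "\<lambda>i. weight n i * (spin n ?\<sigma>' i - spin n \<sigma> i)"
  have "mode n ?\<sigma>' - mode n \<sigma> = (\<Sum>i\<le>n. ?d i)"
    by (simp add: mode_def sum_subtractf right_diff_distrib)
  also have "\<dots> = (\<Sum>i\<in>{v - 1, v}. ?d i)"
    using assms by (intro sum.mono_neutral_right) (auto simp: spin_def recolor_def)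
  finally show ?thesis using assms by (cases v) simp_all
qed

text \<open>
  Lifting colors to heights with steps \<open>+1\<close> or \<open>-1\<close>, both sides are the height difference between
  the ends of a path of two edges. It lies in \<open>{-2, 0, 2}\<close>, so it is determined by its residue
  modulo 3, that is, by the colors \<open>a\<close> and \<open>b\<close>.
\<close>

lemma orient_detour:
  assumes "a \<in> {0, 1, 2}" "s \<in> {0, 1, 2}" "c \<in> {0, 1, 2}" "b \<in> {0, 1, 2}"
    and "a \<noteq> s" "s \<noteq> b" "a \<noteq> c" "c \<noteq> b"
  shows "orient a c + orient c b = orient a s + orient s b"
  using assms unfolding orient_def by (elim insertE emptyE; simp)

text \<open>
  Here \<open>w\<close> and \<open>w + d\<close> are the weights of the edges to the left and right of a vertex of color \<open>s\<close>,
  and \<open>\<delta> c\<close> is the change of the weighted spins when color \<open>c\<close> is proposed. The sum of the two spins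
  is preserved, so only the difference \<open>d\<close> of the weights matters.
\<close>

lemma interior_orient_change:
  fixes w d :: real
  assumes col: "a \<in> {0, 1, 2}" "s \<in> {0, 1, 2}" "b \<in> {0, 1, 2}" "a \<noteq> s" "s \<noteq> b"
  defines "\<delta> \<equiv> \<lambda>c. if a \<noteq> c \<and> b \<noteq> c
    then w * (orient a c - orient a s) + (w + d) * (orient c b - orient s b) else 0"
  shows "\<delta> 0 + \<delta> 1 + \<delta> 2 = d * (orient a s - orient s b)"
    and "\<bar>\<delta> 0\<bar> \<le> 2 * \<bar>d\<bar>" "\<bar>\<delta> 1\<bar> \<le> 2 * \<bar>d\<bar>" "\<bar>\<delta> 2\<bar> \<le> 2 * \<bar>d\<bar>"
proof -
  define \<kappa> where "\<kappa> = (\<lambda>c. if a \<noteq> c \<and> b \<noteq> c then orient c b - orient s b else 0)"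
  have \<delta>: "\<delta> c = d * \<kappa> c" if "c \<in> {0, 1, 2}" for c
  proof (cases "a \<noteq> c \<and> b \<noteq> c")
    case True
    then have eq: "orient a c - orient a s = - (orient c b - orient s b)"
      using orient_detour[OF col(1,2) that col(3-5)] by auto
    show ?thesis
      using True unfolding \<delta>_def \<kappa>_def eq by (simp add: algebra_simps)
  qed (auto simp: \<delta>_def \<kappa>_def)
  have "\<kappa> 0 + \<kappa> 1 + \<kappa> 2 = orient a s - orient s b"
    using col unfolding \<kappa>_def orient_def by (elim insertE emptyE; simp)
  then show "\<delta> 0 + \<delta> 1 + \<delta> 2 = d * (orient a s - orient s b)"
    by (simp add: \<delta> distrib_left[symmetric])
  have "\<bar>d * \<kappa> c\<bar> \<le> 2 * \<bar>d\<bar>" for c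
  proof -
    have "\<bar>\<kappa> c\<bar> \<le> 2" by (simp add: \<kappa>_def orient_def)
    then show ?thesis unfolding abs_mult by (subst mult.commute) (rule mult_right_mono, auto)
  qed
  then show "\<bar>\<delta> 0\<bar> \<le> 2 * \<bar>d\<bar>" "\<bar>\<delta> 1\<bar> \<le> 2 * \<bar>d\<bar>" "\<bar>\<delta> 2\<bar> \<le> 2 * \<bar>d\<bar>"
    by (simp_all only: \<delta> insert_iff simp_thms)
qed

lemma left_end_orient_change:
  fixes d :: real
  assumes "s \<in> {0, 1, 2}" "b \<in> {0, 1, 2}" "s \<noteq> b"
  defines "\<delta> \<equiv> \<lambda>c. if b \<noteq> c then d / 2 * (orient c b - orient s b) else 0"
  shows "\<delta> 0 + \<delta> 1 + \<delta> 2 = d * - orient s b"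
    and "\<bar>\<delta> 0\<bar> \<le> 2 * \<bar>d\<bar>" "\<bar>\<delta> 1\<bar> \<le> 2 * \<bar>d\<bar>" "\<bar>\<delta> 2\<bar> \<le> 2 * \<bar>d\<bar>"
  using assms(1-3) unfolding \<delta>_def orient_def by (elim insertE emptyE; simp)+

lemma right_end_orient_change:
  fixes d :: real
  assumes "a \<in> {0, 1, 2}" "s \<in> {0, 1, 2}" "a \<noteq> s"
  defines "\<delta> \<equiv> \<lambda>c. if a \<noteq> c then - d / 2 * (orient a c - orient a s) else 0"
  shows "\<delta> 0 + \<delta> 1 + \<delta> 2 = d * orient a s"
    and "\<bar>\<delta> 0\<bar> \<le> 2 * \<bar>d\<bar>" "\<bar>\<delta> 1\<bar> \<le> 2 * \<bar>d\<bar>" "\<bar>\<delta> 2\<bar> \<le> 2 * \<bar>d\<bar>"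
  using assms(1-3) unfolding \<delta>_def orient_def by (elim insertE emptyE; simp)+

text \<open>
  The sum over the proposed colors yields the drift and the absolute bound yields the size of an
  increment. Both have one form for interior and end vertices: at an end the weight of the single
  edge is, up to sign, half the weight difference, by oddness of the weights.
\<close>

lemma mode_recolor:
  assumes n: "n \<ge> 2" and \<sigma>: "\<sigma> \<in> proper_colorings n 3" and v: "v \<in> {1..n}"
  shows "(\<Sum>c<3. mode n (recolor n v \<sigma> c) - mode n \<sigma>)
      = (weight n v - weight n (v - 1)) * (spin n \<sigma> (v - 1) - spin n \<sigma> v)" (is ?sum)
    and "c < 3 \<Longrightarrow> \<bar>mode n (recolor n v \<sigma> c) - mode n \<sigma>\<bar>
      \<le> 2 * \<bar>weight n v - weight n (v - 1)\<bar>"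
proof -
  have three: "(\<Sum>c<3. h c) = h 0 + h 1 + h 2" for h :: "nat \<Rightarrow> real"
    by (simp add: eval_nat_numeral)
  define d where "d = weight n v - weight n (v - 1)"
  have local_change: "?sum \<and> (\<forall>c\<in>{0,1,2}. \<bar>mode n (recolor n v \<sigma> c) - mode n \<sigma>\<bar> \<le> 2 * \<bar>d\<bar>)"
  proof -
    consider "v = 1" | "v = n" "v > 1" | "1 < v" "v < n" using v by force
    then show ?thesis
    proof cases
      case 1
      have rec: "recolor n v \<sigma> c = (if \<sigma> 2 \<noteq> c then \<sigma>(1 := c) else \<sigma>)" for c
        using n neighbour_iff[of v n] 1 by (auto simp: recolor_def numeral_2_eq_2)
      have col: "\<sigma> 1 \<in> {0, 1, 2}" "\<sigma> 2 \<in> {0, 1, 2}" "\<sigma> 1 \<noteq> \<sigma> 2"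
        using n color_less_3[OF \<sigma>] adjacent_colors[OF \<sigma>, of 1] by (auto simp: numeral_2_eq_2)
      have "weight n 1 = d / 2" using 1 weight_left[of n] by (simp add: d_def)
      then have step: "mode n (recolor n v \<sigma> c) - mode n \<sigma>
          = d / 2 * (spin n (recolor n v \<sigma> c) 1 - spin n \<sigma> 1)" for c
        using mode_recolor_diff[OF v, of \<sigma> c] 1 by (simp add: spin_def)
      have diff: "mode n (recolor n v \<sigma> c) - mode n \<sigma> = (if \<sigma> 2 \<noteq> c
          then d / 2 * (orient c (\<sigma> 2) - orient (\<sigma> 1) (\<sigma> 2)) else 0)" for c
        unfolding step using n by (simp add: rec spin_def numeral_2_eq_2)
      have ends: "spin n \<sigma> (v - 1) - spin n \<sigma> v = - orient (\<sigma> 1) (\<sigma> 2)"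
        using 1 n by (simp add: spin_def numeral_2_eq_2)
      show ?thesis
        unfolding three diff ends d_def[symmetric] ball_simps(5,7)
        using left_end_orient_change[OF col, of d] by blast
    next
      case 2
      obtain k where k: "n = Suc k" "v = Suc k" "k \<ge> 1" using 2 by (cases n) auto
      then have "k < n" by simp
      have rec: "recolor n v \<sigma> c = (if \<sigma> k \<noteq> c then \<sigma>(Suc k := c) else \<sigma>)" for c
        using n neighbour_iff[of v n] k by (auto simp: recolor_def)
      have col: "\<sigma> k \<in> {0, 1, 2}" "\<sigma> (Suc k) \<in> {0, 1, 2}" "\<sigma> k \<noteq> \<sigma> (Suc k)"
        using n k color_less_3[OF \<sigma>] adjacent_colors[OF \<sigma>, of k] by auto
      have "weight n (v - 1) = - d / 2" using 2 weight_right[OF n] by (simp add: d_def)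
      then have step: "mode n (recolor n v \<sigma> c) - mode n \<sigma>
          = - d / 2 * (spin n (recolor n v \<sigma> c) k - spin n \<sigma> k)" for c
        using mode_recolor_diff[OF v, of \<sigma> c] k by (simp add: spin_def)
      have diff: "mode n (recolor n v \<sigma> c) - mode n \<sigma> = (if \<sigma> k \<noteq> c
          then - d / 2 * (orient (\<sigma> k) c - orient (\<sigma> k) (\<sigma> (Suc k))) else 0)" for c
        unfolding step unfolding rec using \<open>k \<ge> 1\<close> \<open>k < n\<close> by (simp add: spin_def)
      have ends: "spin n \<sigma> (v - 1) - spin n \<sigma> v = orient (\<sigma> k) (\<sigma> (Suc k))"
        using k by (simp add: spin_def)
      show ?thesis
        unfolding three diff ends d_def[symmetric] ball_simps(5,7)
        using right_end_orient_change[OF col, of d] by blast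
    next
      case 3
      obtain k where k: "v = Suc k" "k \<ge> 1" "Suc k < n" using 3 by (cases v) auto
      have rec: "recolor n v \<sigma> c
          = (if \<sigma> k \<noteq> c \<and> \<sigma> (Suc (Suc k)) \<noteq> c then \<sigma>(Suc k := c) else \<sigma>)" for c
        using n neighbour_iff[of v n] k by (auto simp: recolor_def)
      have col: "\<sigma> k \<in> {0, 1, 2}" "\<sigma> (Suc k) \<in> {0, 1, 2}" "\<sigma> (Suc (Suc k)) \<in> {0, 1, 2}"
          "\<sigma> k \<noteq> \<sigma> (Suc k)" "\<sigma> (Suc k) \<noteq> \<sigma> (Suc (Suc k))"
        using n k color_less_3[OF \<sigma>] adjacent_colors[OF \<sigma>, of k]
          adjacent_colors[OF \<sigma>, of "Suc k"] by auto
      have "weight n v = weight n k + d" using k by (simp add: d_def)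
      then have step: "mode n (recolor n v \<sigma> c) - mode n \<sigma>
          = weight n k * (spin n (recolor n v \<sigma> c) k - spin n \<sigma> k)
            + (weight n k + d) * (spin n (recolor n v \<sigma> c) (Suc k) - spin n \<sigma> (Suc k))" for c
        using mode_recolor_diff[OF v, of \<sigma> c] k by simp
      have diff: "mode n (recolor n v \<sigma> c) - mode n \<sigma>
          = (if \<sigma> k \<noteq> c \<and> \<sigma> (Suc (Suc k)) \<noteq> c
             then weight n k * (orient (\<sigma> k) c - orient (\<sigma> k) (\<sigma> (Suc k)))
               + (weight n k + d)
                 * (orient c (\<sigma> (Suc (Suc k))) - orient (\<sigma> (Suc k)) (\<sigma> (Suc (Suc k))))
             else 0)" for c
        unfolding step unfolding rec using k(2,3) by (simp add: spin_def)
      have ends: "spin n \<sigma> (v - 1) - spin n \<sigma> v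
          = orient (\<sigma> k) (\<sigma> (Suc k)) - orient (\<sigma> (Suc k)) (\<sigma> (Suc (Suc k)))"
        using k by (simp add: spin_def)
      show ?thesis
        unfolding three diff ends d_def[symmetric] ball_simps(5,7)
        using interior_orient_change[OF col, of "weight n k" d] by blast
    qed
  qed
  show ?sum using local_change ..
  show "\<bar>mode n (recolor n v \<sigma> c) - mode n \<sigma>\<bar> \<le> 2 * \<bar>weight n v - weight n (v - 1)\<bar>"
    if "c < 3"
  proof -
    have "c \<in> {0, 1, 2}" using that by auto
    then show ?thesis using local_change unfolding d_def by blast
  qed
qed

lemma expectation_glauber:
  fixes f :: "(nat \<Rightarrow> nat) \<Rightarrow> real"
  assumes "n \<ge> 1"
  shows "measure_pmf.expectation (glauber n 3 \<sigma>) f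
    = (\<Sum>v=1..n. \<Sum>c<3. f (recolor n v \<sigma> c)) / (3 * real n)"
proof -
  have "measure_pmf.expectation (metropolis n 3 v \<sigma>) f = (\<Sum>c<3. f (recolor n v \<sigma> c)) / 3" for v
    by (simp add: metropolis_def integral_pmf_of_set lessThan_atLeast0)
  moreover have "finite (set_pmf (metropolis n 3 v \<sigma>))" for v
    by (simp add: metropolis_def)
  ultimately show ?thesis
    using assms unfolding glauber_def
    by (subst pmf_expectation_bind_pmf_of_set)
      (simp_all add: sum_divide_distrib field_simps)
qed

lemma sum_by_parts_path:
  fixes w x :: "nat \<Rightarrow> real"
  assumes "x 0 = 0"
  shows "(\<Sum>v=1..n. (w v - w (v - 1)) * (x (v - 1) - x v))
    = (\<Sum>i=1..n. (w (i + 1) - 2 * w i + w (i - 1)) * x i) - (w (n + 1) - w n) * x n"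
  using assms by (induction n) (simp_all add: algebra_simps)

text \<open>
  Summation by parts moves the differences from the spins to the weights, which are an eigenvector of
  the discrete Laplacian.
\<close>

lemma mode_drift:
  assumes n: "n \<ge> 2" and \<sigma>: "\<sigma> \<in> proper_colorings n 3"
  shows "measure_pmf.expectation (glauber n 3 \<sigma>) (mode n) = (1 - mode_gap n) * mode n \<sigma>"
proof -
  let ?L = "- 2 * (1 - cos (pi / (real n - 1)))"
  have "(\<Sum>v=1..n. \<Sum>c<3. mode n (recolor n v \<sigma> c) - mode n \<sigma>)
      = (\<Sum>v=1..n. (weight n v - weight n (v - 1)) * (spin n \<sigma> (v - 1) - spin n \<sigma> v))"
    using mode_recolor(1)[OF n \<sigma>] by (intro sum.cong) auto
  also have "\<dots> = (\<Sum>i=1..n. (weight n (i + 1) - 2 * weight n i + weight n (i - 1)) * spin n \<sigma> i)"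
    by (subst sum_by_parts_path) (simp_all add: spin_def)
  also have "\<dots> = (\<Sum>i=1..n. ?L * (weight n i * spin n \<sigma> i))"
    by (intro sum.cong refl) (subst weight_laplacian, auto)
  also have "\<dots> = ?L * (\<Sum>i=1..n. weight n i * spin n \<sigma> i)"
    by (rule sum_distrib_left[symmetric])
  also have "(\<Sum>i=1..n. weight n i * spin n \<sigma> i) = mode n \<sigma>"
    unfolding mode_def by (intro sum.mono_neutral_left) (auto simp: spin_def)
  finally have "(\<Sum>v=1..n. \<Sum>c<3. mode n (recolor n v \<sigma> c)) - 3 * real n * mode n \<sigma>
      = ?L * mode n \<sigma>"
    by (simp add: sum_subtractf)
  then have "(\<Sum>v=1..n. \<Sum>c<3. mode n (recolor n v \<sigma> c)) = (3 * real n + ?L) * mode n \<sigma>"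
    by (simp add: algebra_simps)
  then show ?thesis
    using n by (simp add: expectation_glauber mode_gap_def field_simps)
qed

lemma mode_increment:
  assumes n: "n \<ge> 2" and \<sigma>: "\<sigma> \<in> proper_colorings n 3"
  shows "measure_pmf.expectation (glauber n 3 \<sigma>) (\<lambda>\<tau>. (mode n \<tau> - mode n \<sigma>)\<^sup>2)
    \<le> (2 * pi / (real n - 1))\<^sup>2"
proof -
  let ?B = "(2 * pi / (real n - 1))\<^sup>2"
  have B: "(mode n (recolor n v \<sigma> c) - mode n \<sigma>)\<^sup>2 \<le> ?B" if v: "v \<in> {1..n}" and c: "c < 3" for v c
  proof -
    have "\<bar>mode n (recolor n v \<sigma> c) - mode n \<sigma>\<bar> \<le> 2 * \<bar>weight n v - weight n (v - 1)\<bar>"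
      using n \<sigma> v c by (rule mode_recolor(2))
    also have "\<dots> \<le> 2 * (pi / (real n - 1))"
      using n v by (intro mult_left_mono weight_lipschitz) auto
    finally have "\<bar>mode n (recolor n v \<sigma> c) - mode n \<sigma>\<bar> \<le> 2 * pi / (real n - 1)" by simp
    then show ?thesis by (metis abs_ge_zero power2_abs power_mono)
  qed
  have "(\<Sum>v=1..n. \<Sum>c<3. (mode n (recolor n v \<sigma> c) - mode n \<sigma>)\<^sup>2) \<le> (\<Sum>v=1..n. \<Sum>c<3::nat. ?B)"
    using B by (intro sum_mono) auto
  also have "\<dots> = 3 * real n * ?B" by simp
  finally show ?thesis
    using n by (simp add: expectation_glauber divide_le_eq mult.commute)
qed

lemma glauber_support:
  assumes "n \<ge> 1" "\<sigma> \<in> proper_colorings n 3"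
  shows "set_pmf (glauber n 3 \<sigma>) \<subseteq> proper_colorings n 3"
  using assms recolor_proper[of \<sigma> n 3] by (auto simp: glauber_def metropolis_def)

text \<open>
  All spins are \<open>+1\<close>: the coloring of maximal height difference, which makes the mode largest.
\<close>

definition staircase :: "nat \<Rightarrow> nat \<Rightarrow> nat" where
  "staircase n = (\<lambda>i\<in>{1..n}. i mod 3)"

lemma staircase_proper: "staircase n \<in> proper_colorings n 3"
proof -
  have "staircase n \<in> colorings n 3" by (simp add: staircase_def colorings_def)
  moreover have "staircase n u \<noteq> staircase n v" if edge: "{u, v} \<in> path_edges n" for u v
  proof -
    have "u \<in> {1..n}" "v \<in> {1..n}" "v = Suc u \<or> u = Suc v"
      using edge by (auto simp: path_edges_def doubleton_eq_iff)
    then show ?thesis by (auto simp: staircase_def mod_Suc split: if_splits)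
  qed
  ultimately show ?thesis by (simp add: proper_colorings_def)
qed

text \<open>
  Multiplied by \<open>2 sin (h / 2)\<close>, where \<open>h = pi / (n - 1)\<close>, the sum of the weights telescopes to
  \<open>cos 0 - cos pi = 2\<close>. So the mode equals \<open>1 / sin (h / 2)\<close>.
\<close>

lemma mode_staircase:
  assumes n: "n \<ge> 2"
  shows "mode n (staircase n) \<ge> 2 * (real n - 1) / pi"
proof -
  define h where "h = pi / (real n - 1)"
  have h: "h > 0" "h * (real n - 1) = pi" "h \<le> pi" using n by (simp_all add: h_def field_simps)
  have "spin n (staircase n) i = 1" if "i \<in> {1..<n}" for i
    using that by (auto simp: spin_def staircase_def orient_def mod_Suc_eq)
  then have "mode n (staircase n) = (\<Sum>i=1..<n. weight n i)"
    unfolding mode_def by (intro sum.mono_neutral_cong_right) (auto simp: spin_def)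
  moreover have "2 * sin (h / 2) * (\<Sum>i=1..<n. weight n i) = 2"
  proof -
    have w: "2 * sin (h / 2) * weight n i = cos (h * (real i - 1)) - cos (h * real i)" for i
    proof -
      have "weight n i = sin (h * (real i - 1/2))" by (simp add: weight_def h_def)
      moreover have "h * (real i - 1) = h * (real i - 1/2) - h / 2"
        "h * real i = h * (real i - 1/2) + h / 2" by (simp_all add: algebra_simps)
      ultimately show ?thesis by (simp only: cos_add cos_diff) simp
    qed
    have "2 * sin (h / 2) * (\<Sum>i=1..<n. weight n i)
        = (\<Sum>i=1..<n. - cos (h * (real (Suc i) - 1)) - - cos (h * (real i - 1)))"
      unfolding sum_distrib_left w by (intro sum.cong) auto
    also have "\<dots> = 2"
      using n h(2) by (subst sum_Suc_diff') auto
    finally show ?thesis .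
  qed
  ultimately have eq: "sin (h / 2) * mode n (staircase n) = 1" by simp
  have pos: "sin (h / 2) > 0" using h by (intro sin_gt_zero) auto
  have "sin (h / 2) \<le> h / 2" using h by (intro sin_x_le_x) auto
  then have "1 / (h / 2) \<le> 1 / sin (h / 2)" using pos by (intro divide_left_mono) auto
  also have "1 / sin (h / 2) = mode n (staircase n)" using eq pos by (simp add: field_simps)
  also have "1 / (h / 2) = 2 * (real n - 1) / pi" by (simp add: h_def)
  finally show ?thesis .
qed

lemma abs_sin_multiple_le: "\<bar>sin (real k * x)\<bar> \<le> real k * \<bar>sin x\<bar>"
proof (induction k)
  case (Suc k)
  have "\<bar>sin (real (Suc k) * x)\<bar>
      \<le> \<bar>sin (real k * x)\<bar> * \<bar>cos x\<bar> + \<bar>cos (real k * x)\<bar> * \<bar>sin x\<bar>"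
    using abs_triangle_ineq[of "sin (real k * x) * cos x" "cos (real k * x) * sin x"]
    by (simp add: sin_add[symmetric] abs_mult) (simp add: algebra_simps)
  also have "\<dots> \<le> \<bar>sin (real k * x)\<bar> * 1 + 1 * \<bar>sin x\<bar>"
    by (intro add_mono mult_mono) auto
  finally show ?case using Suc by (simp add: algebra_simps)
qed simp

text \<open>
  The upper bound is the sharp one that determines the constant of the mixing time. The lower bound
  controls the variance, where the order of magnitude suffices; it follows from
  \<open>1 = sin ((n - 1) a) \<le> (n - 1) sin a\<close> for \<open>a = pi / (2 (n - 1))\<close>.
\<close>

lemma mode_gap_bounds:
  assumes n: "n \<ge> 2"
  shows "mode_gap n \<ge> 4 / (3 * real n * (real n - 1)\<^sup>2)"
    and "mode_gap n \<le> pi\<^sup>2 / (3 * real n * (real n - 1)\<^sup>2)"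
    and "mode_gap n > 0"
proof -
  define N where "N = real n - 1"
  have N: "N \<ge> 1" using n by (simp add: N_def)
  define a where "a = pi / N / 2"
  have a: "0 < a" "a \<le> pi / 2" using N by (simp_all add: a_def field_simps)
  have gap: "mode_gap n = 4 / (3 * real n) * (sin a)\<^sup>2"
  proof -
    have "cos (pi / N) = 1 - 2 * (sin a)\<^sup>2" using cos_double_sin[of a] by (simp add: a_def)
    then show ?thesis by (simp add: mode_gap_def N_def)
  qed
  have "sin a \<ge> 1 / N"
  proof -
    have "real (n - 1) = N" using n by (simp add: N_def of_nat_diff)
    then have "\<bar>sin (N * a)\<bar> \<le> N * \<bar>sin a\<bar>"
      using abs_sin_multiple_le[of "n - 1" a] by simp
    moreover have "N * a = pi / 2" using N by (simp add: a_def)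
    ultimately have "\<bar>sin (pi / 2)\<bar> \<le> N * \<bar>sin a\<bar>" by (simp only:)
    then have "1 \<le> N * \<bar>sin a\<bar>" by simp
    moreover have "sin a \<ge> 0" using a by (intro sin_ge_zero) auto
    ultimately show ?thesis using N by (simp add: divide_le_eq mult.commute)
  qed
  then have lo: "(sin a)\<^sup>2 \<ge> (1 / N)\<^sup>2" using N by (intro power_mono) auto
  have "sin a \<ge> 0" using a by (intro sin_ge_zero) auto
  moreover have "sin a \<le> a" using a by (intro sin_x_le_x) auto
  ultimately have up: "(sin a)\<^sup>2 \<le> a\<^sup>2" by (rule power_mono[rotated])
  show *: "mode_gap n \<ge> 4 / (3 * real n * (real n - 1)\<^sup>2)"
    using mult_left_mono[OF lo, of "4 / (3 * real n)"] N
    by (simp add: gap power_divide N_def)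
  show "mode_gap n \<le> pi\<^sup>2 / (3 * real n * (real n - 1)\<^sup>2)"
  proof -
    have "a\<^sup>2 = pi\<^sup>2 / (4 * N\<^sup>2)" by (simp add: a_def power_divide power_mult_distrib)
    then show ?thesis
      using mult_left_mono[OF up, of "4 / (3 * real n)"] by (simp add: gap N_def)
  qed
  have "4 / (3 * real n * (real n - 1)\<^sup>2) > 0" using n by auto
  with * show "mode_gap n > 0" by linarith
qed

section \<open>The mixing time\<close>

lemma power_one_minus_ge_exp:
  fixes \<gamma> :: real
  assumes "0 < \<gamma>" "\<gamma> < 1"
  shows "(1 - \<gamma>) ^ t \<ge> exp (- (real t / (1 / \<gamma> - 1)))"
proof -
  have "1 / (1 - \<gamma>) = 1 + \<gamma> / (1 - \<gamma>)" using assms by (simp add: field_simps)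
  also have "\<dots> \<le> exp (\<gamma> / (1 - \<gamma>))" by (rule exp_ge_add_one_self)
  also have "\<gamma> / (1 - \<gamma>) = 1 / (1 / \<gamma> - 1)" using assms by (simp add: field_simps)
  finally have "exp (- (1 / (1 / \<gamma> - 1))) \<le> 1 - \<gamma>"
    using assms by (simp add: exp_minus field_simps)
  then have "exp (- (1 / (1 / \<gamma> - 1))) ^ t \<le> (1 - \<gamma>) ^ t" by (rule power_mono) simp
  then show ?thesis by (simp add: exp_of_nat_mult[symmetric])
qed

text \<open>
  The constants come from a variance bound \<open>V \<le> (3/2) pi\<^sup>2 n\<close> and an initial value of at least
  \<open>n / pi\<close>: the condition \<open>m\<^sup>2 > 4 V\<close> follows from
  \<open>(1 - \<gamma>)\<^sup>2\<^sup>t n\<^sup>2 / pi\<^sup>2 > 6 pi\<^sup>2 n\<close>, and \<open>7 pi\<^sup>4 > 6 pi\<^sup>4\<close> makes it strict. The subtracted 1 in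
  the time bound comes from \<open>ln (1 - \<gamma>) \<ge> - 1 / (1 / \<gamma> - 1)\<close>.
\<close>

lemma tv_dist_glauber:
  assumes n: "n \<ge> 3"
    and t: "real t \<le> (ln (real n) - ln (7 * pi ^ 4)) / 2 * (3 * real n * (real n - 1)\<^sup>2 / pi\<^sup>2 - 1)"
  shows "tv_dist (proper_colorings n 3) (step_distr (glauber n 3) t (staircase n))
    (pmf_of_set (proper_colorings n 3)) > 1/2"
proof -
  define N where "N = real n - 1"
  define \<gamma> where "\<gamma> = mode_gap n"
  define c where "c = ln (7 * pi ^ 4)"
  have N: "N \<ge> 2" "real n \<le> 2 * N" "real n \<ge> 3" using n by (simp_all add: N_def)
  have lo: "4 / (3 * real n * N\<^sup>2) \<le> \<gamma>" and up: "\<gamma> \<le> pi\<^sup>2 / (3 * real n * N\<^sup>2)" and pos: "\<gamma> > 0"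
    using n mode_gap_bounds[of n] by (simp_all add: \<gamma>_def N_def)
  have "pi\<^sup>2 \<le> 4\<^sup>2" by (intro power_mono) (use pi_less_4 in auto)
  moreover have "3 * 3 * 2\<^sup>2 \<le> 3 * real n * N\<^sup>2" using N by (intro mult_mono power_mono) auto
  ultimately have "pi\<^sup>2 / (3 * real n * N\<^sup>2) \<le> 4\<^sup>2 / (3 * 3 * 2\<^sup>2)"
    by (intro frac_le) auto
  also have "\<dots> \<le> 1/2" by simp
  finally have small: "pi\<^sup>2 / (3 * real n * N\<^sup>2) \<le> 1/2" .
  with up have half: "\<gamma> \<le> 1/2" by simp
  interpret eigenfunction_bounded_increments "proper_colorings n 3" "glauber n 3" "mode n" \<gamma>
    "(2 * pi / N)\<^sup>2"
    using n finite_proper_colorings glauber_support mode_drift mode_increment pos half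
    by unfold_locales (auto simp: \<gamma>_def N_def)
  have variance: "2 * (2 * pi / N)\<^sup>2 / \<gamma> \<le> 6 * pi\<^sup>2 * real n"
  proof -
    have "2 * (2 * pi / N)\<^sup>2 / \<gamma> \<le> 2 * (2 * pi / N)\<^sup>2 / (4 / (3 * real n * N\<^sup>2))"
      using lo N pos by (intro divide_left_mono) auto
    also have "\<dots> = 6 * pi\<^sup>2 * real n" using N by (simp add: power_divide field_simps)
    finally show ?thesis .
  qed
  have rate: "3 * real n * N\<^sup>2 / pi\<^sup>2 - 1 \<le> 1 / \<gamma> - 1"
  proof -
    have "1 / (pi\<^sup>2 / (3 * real n * N\<^sup>2)) \<le> 1 / \<gamma>"
      using up pos N by (intro divide_left_mono) auto
    then show ?thesis by simp
  qed
  have rate_pos: "1 / \<gamma> - 1 > 0" using pos half by (simp add: field_simps)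
  define s where "s = real t / (1 / \<gamma> - 1)"
  have time: "2 * s \<le> ln (real n) - c"
  proof -
    define A where "A = 3 * real n * N\<^sup>2 / pi\<^sup>2 - 1"
    have "3 * real n * N\<^sup>2 / pi\<^sup>2 \<ge> 2"
    proof -
      have "1 / (1 / 2) \<le> 1 / (pi\<^sup>2 / (3 * real n * N\<^sup>2))"
        using small N by (intro divide_left_mono) auto
      then show ?thesis by simp
    qed
    then have "A > 0" unfolding A_def by linarith
    have "s \<le> real t / A"
      unfolding s_def using rate rate_pos \<open>A > 0\<close> by (intro divide_left_mono) (auto simp: A_def)
    also have "\<dots> \<le> (ln (real n) - c) / 2"
      using t \<open>A > 0\<close> by (simp add: A_def c_def N_def field_simps)
    finally show ?thesis by (simp add: field_simps)
  qed
  have "6 * pi\<^sup>2 * real n < 7 * pi\<^sup>2 * real n" using N by simp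
  also have "\<dots> = exp (c - ln (real n)) * (real n / pi)\<^sup>2"
    using N by (simp add: c_def exp_diff power_divide field_simps eval_nat_numeral)
  also have "\<dots> \<le> exp (- (2 * s)) * (real n / pi)\<^sup>2"
    using time by (intro mult_right_mono) auto
  also have "\<dots> = (exp (- s) * (real n / pi))\<^sup>2"
    unfolding power_mult_distrib exp_double[symmetric] by simp
  also have "\<dots> \<le> ((1 - \<gamma>) ^ t * mode n (staircase n))\<^sup>2"
  proof (intro power_mono mult_mono)
    have "real n / pi \<le> 2 * (real n - 1) / pi" using N by (simp add: N_def divide_right_mono)
    also have "\<dots> \<le> mode n (staircase n)" using n by (intro mode_staircase) auto
    finally show "real n / pi \<le> mode n (staircase n)" .
    show "exp (- s) \<le> (1 - \<gamma>) ^ t"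
      unfolding s_def using pos half by (intro power_one_minus_ge_exp) auto
  qed (use half in auto)
  finally have large: "((1 - \<gamma>) ^ t * mode n (staircase n))\<^sup>2 > 2 * (2 * pi / N)\<^sup>2 / \<gamma>"
    using variance by linarith
  show ?thesis
    using staircase_proper n finite_proper_colorings[of n 3] proper_colorings_nonempty[of 3 n] large
    by (intro tv_dist_stationary glauber_stationary) auto
qed

theorem theorem1:
  shows "\<exists>g :: nat \<Rightarrow> real. g \<in> O(\<lambda>n. real n ^ 3) \<and>
    (\<forall>\<^sub>F n in at_top.
       ereal_of_enat (mix (proper_colorings n 3) (glauber n 3)
                          (pmf_of_set (proper_colorings n 3)) (1/2))
       \<ge> ereal (3/2 * (1 / pi\<^sup>2) * real n ^ 3 * ln (real n) + g n))"
proof -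
  define T where "T = (\<lambda>n. (ln (real n) - ln (7 * pi ^ 4)) / 2
    * (3 * real n * (real n - 1)\<^sup>2 / pi\<^sup>2 - 1))"
  define g where "g = (\<lambda>n. T n - 3/2 * (1 / pi\<^sup>2) * real n ^ 3 * ln (real n))"
  \<comment> \<open>With \<open>k\<close> for \<open>1 / pi\<^sup>2\<close>: the terms of order \<open>n\<^sup>3 ln n\<close> cancel, and those of order \<open>n\<^sup>2 ln n\<close>
    are absorbed.\<close>
  have "(\<lambda>n. (ln (real n) - c) / 2 * (3 * real n * (real n - 1)\<^sup>2 * k - 1)
      - 3/2 * k * real n ^ 3 * ln (real n)) \<in> O(\<lambda>n. real n ^ 3)" if "k > 0" "c > 0" for c k :: real
    using that by real_asymp
  from this[of "1 / k" c for c k] have asymp: "(\<lambda>n. (ln (real n) - c) / 2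
      * (3 * real n * (real n - 1)\<^sup>2 / k - 1) - 3/2 * (1 / k) * real n ^ 3 * ln (real n))
      \<in> O(\<lambda>n. real n ^ 3)" if "k > 0" "c > 0" for c k :: real
    using that by (simp only: times_divide_eq_right mult_1_right zero_less_divide_1_iff)
  have "7 * pi ^ 4 > 1"
  proof -
    have "pi ^ 4 \<ge> 1" using pi_gt3 by (intro one_le_power) auto
    then show ?thesis by simp
  qed
  then have pi4: "ln (7 * pi ^ 4) > 0" by (rule ln_gt_zero)
  have "g \<in> O(\<lambda>n. real n ^ 3)"
    unfolding g_def T_def by (rule asymp[OF _ pi4]) simp
  moreover have "\<forall>\<^sub>F n in at_top. ereal (3/2 * (1 / pi\<^sup>2) * real n ^ 3 * ln (real n) + g n)
      \<le> ereal_of_enat (mix (proper_colorings n 3) (glauber n 3)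
          (pmf_of_set (proper_colorings n 3)) (1/2))"
    using eventually_ge_at_top[of 3]
  proof eventually_elim
    case (elim n)
    have "ereal (T n) \<le> ereal_of_enat (mix (proper_colorings n 3) (glauber n 3)
          (pmf_of_set (proper_colorings n 3)) (1/2))"
      using elim finite_proper_colorings staircase_proper tv_dist_glauber
      unfolding T_def by (intro mix_lower_bound[where x = "staircase n"]) auto
    then show ?case by (simp add: g_def)
  qed
  ultimately show ?thesis by (intro exI[of _ g] conjI)
qed

end
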